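(* Let $0<\varphi<1$ and $\sigma_\epsilon>0$, let $\{\epsilon_n\}_{n\in\mathbb{Z}}$ be independent and identically distributed $\mathcal{N}(0,\sigma_\epsilon^2)$ random variables, and let $$\xi_n=\sum_{k=0}^\infty \varphi^k\epsilon_{n-k},\qquad n\in\mathbb{Z},$$ be the associated two-sided Gaussian AR(1) process. Define $\theta_n(\omega):=n+\xi_n(\omega)$ for $n\in\mathbb{Z}$. Then with probability $1$ (i.e. for almost every $\omega$) there exists a sequence $\{s_k^\omega\}_{k\ge 1}$ of nonzero functions in $\mathrm{PW}_{[-1/2,1/2]}$ such that $$\sum_{n\in\mathbb{Z}}|s_k^\omega(\theta_n(\omega))|^2\le \frac{\|s_k^\omega\|_{2}^2}{k}\qquad\text{for all } k\ge 1.$$ Consequently, almost surely the set $\{\theta_n(\omega)\}_{n\in\mathbb{Z}}$ is not a set of stable sampling for $\mathrm{PW}_{[-1/2,1/2]}$.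
   Context: The Fourier transform is $\mathcal{F}(s)(\omega)=\int_{-\infty}^\infty s(t)e^{-2\pi i\omega t}\,dt$, extended to $L^2(\mathbb{R})$ in the usual way. The Paley-Wiener space is $$\mathrm{PW}_{[-1/2,1/2]}=\{s\in C(\mathbb{R})\cap L^2(\mathbb{R}) : \operatorname{supp}(\mathcal{F}(s))\subseteq[-1/2,1/2]\},$$ and $\|\cdot\|_2$ is the $L^2(\mathbb{R})$ norm. A set $\{t_n\}\subseteq\mathbb{R}$ is of stable sampling for $\mathrm{PW}_{[-1/2,1/2]}$ if there is a constant $K$, independent of $s$, such that $\|s\|_{L^2}\le K\left(\sum_n|s(t_n)|^2\right)^{1/2}$ for all $s\in\mathrm{PW}_{[-1/2,1/2]}$. The series defining $\xi_n$ converges almost surely for every $n$. *)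

theory Defs
  imports "HOL-Probability.Probability"
begin

definition square_integrable :: "(real \<Rightarrow> complex) \<Rightarrow> bool" where
  "square_integrable f \<longleftrightarrow>
     f \<in> borel_measurable lborel \<and> integrable lborel (\<lambda>x. (norm (f x))\<^sup>2)"

definition L2_fun_norm :: "(real \<Rightarrow> complex) \<Rightarrow> real" where
  "L2_fun_norm f = sqrt (LINT x|lborel. (norm (f x))\<^sup>2)"

definition fourier :: "(real \<Rightarrow> complex) \<Rightarrow> real \<Rightarrow> complex" where
  "fourier f \<omega> = (LINT t|lborel. f t * exp (- 2 * of_real pi * \<i> * of_real \<omega> * of_real t))"

(* The extension of the Fourier transform from L^1 \<inter> L^2 to L^2 by density and continuity:
   g is a representative of the transform of s.  The transform is determined only up to null
   sets, hence a relation.  L^2 distances are taken as extended nonnegative integrals, so that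
   convergence to 0 is never satisfied through a non-integrable integrand. *)
definition L2_fourier :: "(real \<Rightarrow> complex) \<Rightarrow> (real \<Rightarrow> complex) \<Rightarrow> bool" where
  "L2_fourier s g \<longleftrightarrow>
     square_integrable s \<and> square_integrable g \<and>
     (\<exists>u :: nat \<Rightarrow> real \<Rightarrow> complex.
        (\<forall>j. integrable lborel (u j) \<and> square_integrable (u j)) \<and>
        (\<lambda>j. \<integral>\<^sup>+x. ennreal ((norm (u j x - s x))\<^sup>2) \<partial>lborel) \<longlonglongrightarrow> 0 \<and>
        (\<lambda>j. \<integral>\<^sup>+\<omega>. ennreal ((norm (fourier (u j) \<omega> - g \<omega>))\<^sup>2) \<partial>lborel) \<longlonglongrightarrow> 0)"

(* Support of an almost-everywhere class: the complement of the largest open set on which g vanishes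
   almost everywhere,
   so it does not depend on the chosen representative. *)
definition ae_support :: "(real \<Rightarrow> complex) \<Rightarrow> real set" where
  "ae_support g = - \<Union>{U. open U \<and> (AE x in lborel. x \<in> U \<longrightarrow> g x = 0)}"

definition paley_wiener :: "real set \<Rightarrow> (real \<Rightarrow> complex) set" where
  "paley_wiener A = {s. continuous_on UNIV s \<and> square_integrable s \<and>
     (\<exists>g. L2_fourier s g \<and> ae_support g \<subseteq> A)}"

(* The sum runs over the index of the family t.  If it diverges, the right-hand side is
   infinite and the inequality imposes nothing; since infsum is 0 in that case, the
   inequality is required only when the samples are square-summable. *)
definition stable_sampling :: "('i \<Rightarrow> real) \<Rightarrow> (real \<Rightarrow> complex) set \<Rightarrow> bool" where
  "stable_sampling t V \<longleftrightarrow>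
     (\<exists>K::real. \<forall>s\<in>V. (\<lambda>n. (norm (s (t n)))\<^sup>2) summable_on UNIV \<longrightarrow>
        L2_fun_norm s \<le> K * sqrt (\<Sum>\<^sub>\<infinity>n. (norm (s (t n)))\<^sup>2))"

end

theory Submission imports Defs begin

text \<open>
  The translates of $t \mapsto \mathrm{sinc}^2(\pi t/2)$ lie in the Paley--Wiener space, all have
  the same norm and are bounded by $1/(t-x)^2$, so it suffices to find, for every $R$, a
  centre $x$ and an index $m$ with $|\theta_n - x| \ge (|n-m|+R)/4$ for all $n$: the sum of
  squared samples is then $O(R^{-2})$.

  Such a gap is produced by a long run of large innovations $\epsilon_m,\dots,\epsilon_{m+N}$: the run
  pushes the points $\theta_m,\dots,\theta_{m+N}$ to the right by at least $R$, while the points before $m$ stay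
  where they were, provided that the innovations outside the run obey
  $|\epsilon_j| \le A + c\,\mathrm{dist}(j, \mathrm{run})$. A run at a given place has some tiny probability $p$, but
  among about $K/p$ disjoint windows one occurs with probability at least $1-e^{-K}$. The
  surroundings of a window are independent of the window itself and violate the growth condition with
  probability $\delta$, where $\delta \to 0$ as $A \to \infty$ uniformly in $R$ and $N$; hence
  the total failure probability is at most $e^{-K} + (K+1)\delta$, which is arbitrarily small.
\<close>

subsection \<open>Shifted squared sinc functions\<close>

definition sinc_sq :: "real \<Rightarrow> real" where
  "sinc_sq x = (sinc x)\<^sup>2"

lemma sinc_sq_0 [simp]: "sinc_sq 0 = 1"
  by (simp add: sinc_sq_def)

lemma sinc_sq_nonneg [simp]: "0 \<le> sinc_sq x"
  by (simp add: sinc_sq_def)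

lemma sinc_sq_minus [simp]: "sinc_sq (- x) = sinc_sq x"
  by (simp add: sinc_sq_def)

lemma continuous_on_sinc_sq [continuous_intros]:
  "continuous_on A f \<Longrightarrow> continuous_on A (\<lambda>x. sinc_sq (f x))" for f :: "'a::topological_space \<Rightarrow> real"
  unfolding sinc_sq_def
  by (intro continuous_on_power continuous_on_compose2[OF continuous_on_sinc[of UNIV "\<lambda>x. x"]])
     (auto intro: continuous_on_id)

lemma borel_measurable_sinc_sq [measurable]: "sinc_sq \<in> borel_measurable borel"
  by (intro borel_measurable_continuous_onI continuous_intros)

lemma sinc_sq_le_1: "sinc_sq x \<le> 1"
proof (cases "x = 0")
  case False
  have "\<bar>sin x\<bar> \<le> \<bar>x\<bar>" by (rule abs_sin_x_le_abs_x)
  then show ?thesis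
    using False by (simp add: sinc_sq_def abs_square_le_1 abs_divide divide_le_eq_1 del: power_divide)
qed simp

lemma sinc_sq_mult_le_1: "sinc_sq x * x\<^sup>2 \<le> 1"
  by (simp add: sinc_sq_def power_divide abs_square_le_1)

lemma integrable_sinc_sq: "integrable lborel sinc_sq"
proof (rule Bochner_Integration.integrable_bound)
  have "integrable lborel (\<lambda>x::real. inverse (1 + x\<^sup>2))"
    using integrable_inverse_1_plus_square by (simp add: set_integrable_def)
  then show "integrable lborel (\<lambda>x::real. 2 * inverse (1 + x\<^sup>2))"
    by simp
  have "sinc_sq x \<le> 2 * inverse (1 + x\<^sup>2)" for x
  proof -
    \<comment> \<open>The factor 2 is the sum of the bound 1 near the origin and the bound 1 for
      \<open>sinc_sq x * x\<^sup>2\<close>.\<close>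
    have "sinc_sq x * (1 + x\<^sup>2) \<le> 2"
      using sinc_sq_le_1[of x] sinc_sq_mult_le_1[of x] by (simp add: algebra_simps)
    moreover have "0 < 1 + x\<^sup>2" by (simp add: add_pos_nonneg)
    ultimately show ?thesis by (simp add: field_simps)
  qed
  then show "AE x in lborel. norm (sinc_sq x) \<le> norm (2 * inverse (1 + x\<^sup>2))"
    by (auto simp: add_nonneg_nonneg abs_mult)
qed simp

lemma integrable_sinc_sq_affine:
  assumes "a \<noteq> 0" shows "integrable lborel (\<lambda>t. sinc_sq (a * (t - x) / 2))"
proof -
  have "(\<lambda>t. sinc_sq (a * (t - x) / 2)) = (\<lambda>t. sinc_sq (- a * x / 2 + a / 2 * t))"
    by (intro ext arg_cong[where f = sinc_sq]) (simp add: field_simps)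
  then show ?thesis
    using lborel_integrable_real_affine[OF integrable_sinc_sq, of "a / 2" "- a * x / 2"] assms by simp
qed

section \<open>Fejer kernels and their scaling\<close>

definition fejer :: "real \<Rightarrow> real \<Rightarrow> real" where
  "fejer a t = a\<^sup>2 * sinc_sq (a * t / 2)"

text \<open>This form, linear in the cosine, explains the factor \<open>a\<^sup>2\<close> in
  \<open>fejer\<close>: a product with a further cosine is again a combination of such kernels by
  the product-to-sum formula.\<close>

lemma fejer_eq: "t \<noteq> 0 \<Longrightarrow> fejer a t = 2 * (1 - cos (a * t)) / t\<^sup>2"
  using cos_double_sin[of "a * t / 2"]
  by (cases "a = 0") (simp_all add: fejer_def sinc_sq_def field_simps power2_eq_square)

lemma integrable_fejer: "integrable lborel (fejer a)"
  unfolding fejer_def[abs_def]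
  using integrable_sinc_sq_affine[of a 0] by (cases "a = 0") simp_all

text \<open>The substitution contributes 1/|a|, which turns the prefactor a^2 into |a|.\<close>

lemma integral_fejer: "(LINT t|lborel. fejer a t) = \<bar>a\<bar> * (LINT t|lborel. sinc_sq (t / 2))"
proof (cases "a = 0")
  case False
  have "(LINT t|lborel. sinc_sq (t / 2)) = \<bar>a\<bar> * (LINT t|lborel. sinc_sq (a * t / 2))"
    using lborel_integral_real_affine[OF False, of "\<lambda>t. sinc_sq (t / 2)" 0] by simp
  moreover have "a\<^sup>2 = \<bar>a\<bar> * \<bar>a\<bar>" by (simp add: power2_eq_square)
  ultimately show ?thesis unfolding fejer_def by (simp only: integral_mult_right_zero mult.assoc)
qed (simp add: fejer_def)

text \<open>By scaling, the integral of \<open>fejer a\<close> is proportional to \<open>\<bar>a\<bar>\<close>; hence the Fourier transform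
  of \<open>sinc_sq\<close> is a second difference of the absolute value, which has compact support. This
  avoids any inversion theorem and the value of the integral.\<close>

lemma sinc_sq_mult_cos:
  "sinc_sq (pi * t / 2) * cos (y * t) =
     (fejer (y + pi) t + fejer (y - pi) t - 2 * fejer y t) / (2 * pi\<^sup>2)"
proof (cases "t = 0")
  case True
  \<comment> \<open>At 0 the numerator is (y + pi)^2 + (y - pi)^2 - 2 y^2 = 2 pi^2.\<close>
  then show ?thesis by (simp add: fejer_def power2_eq_square field_simps)
next
  case False
  have "sinc_sq (pi * t / 2) = 2 * (1 - cos (pi * t)) / t\<^sup>2 / pi\<^sup>2"
    using fejer_eq[OF False, of pi] unfolding fejer_def
    by (metis nonzero_mult_div_cancel_left pi_neq_zero power_not_zero)
  moreover have "2 * (1 - cos (pi * t)) * cos (y * t) =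
      (1 - cos ((y + pi) * t)) + (1 - cos ((y - pi) * t)) - 2 * (1 - cos (y * t))"
    by (simp add: algebra_simps cos_add cos_diff)
  ultimately have "sinc_sq (pi * t / 2) * cos (y * t) =
      ((1 - cos ((y + pi) * t)) + (1 - cos ((y - pi) * t)) - 2 * (1 - cos (y * t))) / t\<^sup>2 / pi\<^sup>2"
    by simp
  then show ?thesis
    unfolding fejer_eq[OF False] by (simp add: add_divide_distrib diff_divide_distrib)
qed

text \<open>The scale pi/2 puts the spectrum on [-1/2, 1/2]; squaring the sinc gives the quadratic
  decay needed for the samples.\<close>

definition bump :: "real \<Rightarrow> real \<Rightarrow> complex" where
  "bump x t = of_real (sinc_sq (pi * (t - x) / 2))"

text \<open>With u = 2 pi \<omega> the bracket is the triangle function 2 max(0, pi - |u|), written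
  as a second difference of |u|.\<close>

definition bump_hat :: "real \<Rightarrow> real" where
  "bump_hat \<omega> = (LINT t|lborel. sinc_sq (t / 2)) *
     (\<bar>2 * pi * \<omega> + pi\<bar> + \<bar>2 * pi * \<omega> - pi\<bar> - 2 * \<bar>2 * pi * \<omega>\<bar>) / (2 * pi\<^sup>2)"

lemma integral_sinc_sq_mult_cos:
  "(LINT t|lborel. sinc_sq (pi * t / 2) * cos (2 * pi * \<omega> * t)) = bump_hat \<omega>"
proof -
  have "(LINT t|lborel. sinc_sq (pi * t / 2) * cos (2 * pi * \<omega> * t)) =
     ((LINT t|lborel. fejer (2 * pi * \<omega> + pi) t)
      + (LINT t|lborel. fejer (2 * pi * \<omega> - pi) t)
      - 2 * (LINT t|lborel. fejer (2 * pi * \<omega>) t)) / (2 * pi\<^sup>2)"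
    unfolding sinc_sq_mult_cos by (simp add: integrable_fejer)
  also have "\<dots> = bump_hat \<omega>"
    unfolding bump_hat_def integral_fejer by (simp add: algebra_simps)
  finally show ?thesis .
qed

text \<open>Reflection shows that the integral is its own negative; if \<open>f\<close> is not
  integrable, the integral is 0 by convention.\<close>

lemma integral_odd_eq_0:
  fixes f :: "real \<Rightarrow> real"
  assumes "\<And>t. f (- t) = - f t" shows "(LINT t|lborel. f t) = 0"
  using lborel_integral_real_affine[of "-1" f 0] assms by simp

section \<open>Decay and Fourier transform of the translates\<close>

lemma integrable_bump: "integrable lborel (bump x)"
  unfolding bump_def[abs_def] by (intro integrable_of_real integrable_sinc_sq_affine) simp

lemma continuous_on_bump: "continuous_on UNIV (bump x)"
  unfolding bump_def[abs_def] by (intro continuous_intros) simp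

lemma borel_measurable_bump [measurable]: "bump x \<in> borel_measurable borel"
  by (intro borel_measurable_continuous_onI continuous_on_bump)

lemma norm_bump [simp]: "norm (bump x t) = sinc_sq (pi * (t - x) / 2)"
  by (simp add: bump_def)

lemma norm_bump_le:
  assumes "t \<noteq> x" shows "norm (bump x t) \<le> 1 / (t - x)\<^sup>2"
proof -
  have "1 \<le> pi\<^sup>2 / 4"
    \<comment> \<open>The decay of sinc gives the constant 4/pi^2, which is at most 1.\<close>
    using power_mono[of 2 pi 2] pi_ge_two by simp
  then have "(norm (bump x t) * (t - x)\<^sup>2) * 1 \<le> (norm (bump x t) * (t - x)\<^sup>2) * (pi\<^sup>2 / 4)"
    by (intro mult_left_mono) simp_all
  also have "\<dots> = norm (bump x t) * (pi * (t - x) / 2)\<^sup>2"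
    by (simp add: power_divide power_mult_distrib)
  also have "\<dots> \<le> 1"
    unfolding norm_bump by (rule sinc_sq_mult_le_1)
  finally show ?thesis
    using assms by (simp add: field_simps)
qed

lemma square_integrable_bump: "square_integrable (bump x)"
  unfolding square_integrable_def
proof
  show "integrable lborel (\<lambda>t. (norm (bump x t))\<^sup>2)"
  proof (rule Bochner_Integration.integrable_bound[OF integrable_norm[OF integrable_bump]])
    show "AE t in lborel. norm ((norm (bump x t))\<^sup>2) \<le> norm (norm (bump x t))"
      by (auto simp: power2_eq_square intro!: mult_left_le sinc_sq_le_1)
  qed simp
qed simp

text \<open>Translation becomes modulation, which reduces to the centred function. There the real
  part is the cosine integral computed above, and the imaginary part is the integral of an odd
  function.\<close>

lemma fourier_bump:
  "fourier (bump x) \<omega> = exp (- 2 * of_real pi * \<i> * of_real \<omega> * of_real x) * of_real (bump_hat \<omega>)"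
proof -
  let ?e = "\<lambda>t::real. exp (- 2 * of_real pi * \<i> * of_real \<omega> * of_real t) :: complex"
  have e: "?e t = cis (- (2 * pi * \<omega> * t))" for t
    unfolding cis_conv_exp by (simp add: algebra_simps)
  have e_add: "?e (x + t) = ?e x * ?e t" for t
    by (simp add: exp_add[symmetric] algebra_simps)
  let ?f = "\<lambda>t. bump 0 t * ?e t"
  have f: "integrable lborel ?f"
  proof (rule Bochner_Integration.integrable_bound[OF integrable_bump[of 0]])
    show "?f \<in> borel_measurable lborel"
      unfolding bump_def by measurable
    show "AE t in lborel. norm (?f t) \<le> norm (bump 0 t)"
      unfolding e by (simp add: norm_mult)
  qed
  have "fourier (bump x) \<omega> = (LINT t|lborel. bump x (x + 1 * t) * ?e (x + 1 * t))"
    unfolding fourier_def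
    by (subst lborel_integral_real_affine[of 1 _ x]) simp_all
  also have "\<dots> = (LINT t|lborel. ?e x * ?f t)"
    unfolding mult_1 e_add by (intro Bochner_Integration.integral_cong) (auto simp: bump_def)
  also have "\<dots> = ?e x * (LINT t|lborel. ?f t)"
    by simp
  also have "(LINT t|lborel. ?f t) = of_real (bump_hat \<omega>)"
  proof (rule complex_eqI)
    have "Re (LINT t|lborel. ?f t) = (LINT t|lborel. Re (?f t))"
      by (simp only: integral_Re[OF f])
    also have "\<dots> = bump_hat \<omega>"
      unfolding integral_sinc_sq_mult_cos[symmetric] e by (simp add: bump_def)
    finally show "Re (LINT t|lborel. ?f t) = Re (of_real (bump_hat \<omega>))" by simp
    have "Im (LINT t|lborel. ?f t) = (LINT t|lborel. Im (?f t))"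
      by (simp only: integral_Im[OF f])
    also have "\<dots> = 0"
      unfolding e by (rule integral_odd_eq_0) (simp add: bump_def)
    finally show "Im (LINT t|lborel. ?f t) = Im (of_real (bump_hat \<omega>))" by simp
  qed
  finally show ?thesis .
qed

text \<open>Off the band, u = 2 pi \<omega> and u + pi, u - pi lie on one side of 0, where the
  absolute value is linear and its second difference vanishes.\<close>

lemma bump_hat_eq_0: "\<omega> \<notin> {-1/2..1/2} \<Longrightarrow> bump_hat \<omega> = 0"
proof -
  assume "\<omega> \<notin> {-1/2..1/2}"
  then consider "\<omega> \<ge> 1/2" | "\<omega> \<le> - 1/2" by fastforce
  then have "\<bar>2 * pi * \<omega> + pi\<bar> + \<bar>2 * pi * \<omega> - pi\<bar> - 2 * \<bar>2 * pi * \<omega>\<bar> = 0"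
  proof cases
    case 1
    then have "2 * pi * \<omega> \<ge> 2 * pi * (1/2)" by (intro mult_left_mono) auto
    then have "2 * pi * \<omega> \<ge> pi" by simp
    then show ?thesis using pi_gt_zero by linarith
  next
    case 2
    then have "2 * pi * \<omega> \<le> 2 * pi * (- 1/2)" by (intro mult_left_mono) auto
    then have "2 * pi * \<omega> \<le> - pi" by simp
    then show ?thesis using pi_gt_zero by linarith
  qed
  then show ?thesis by (simp add: bump_hat_def)
qed

text \<open>The transform is continuous and vanishes off a compact interval.\<close>

lemma square_integrable_fourier_bump: "square_integrable (fourier (bump x))"
  unfolding square_integrable_def
proof
  have cont: "continuous_on A (fourier (bump x))" for A
    unfolding fourier_bump[abs_def] bump_hat_def by (intro continuous_intros) auto
  then show "fourier (bump x) \<in> borel_measurable lborel"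
    by (simp add: borel_measurable_continuous_onI)
  have "set_integrable lborel {-1/2..1/2} (\<lambda>\<omega>. (norm (fourier (bump x) \<omega>))\<^sup>2)"
    by (intro borel_integrable_atLeastAtMost' continuous_intros cont)
  moreover have "(\<lambda>\<omega>. indicator {-1/2..1/2} \<omega> *\<^sub>R (norm (fourier (bump x) \<omega>))\<^sup>2) =
      (\<lambda>\<omega>. (norm (fourier (bump x) \<omega>))\<^sup>2)"
    using bump_hat_eq_0 by (auto simp: fun_eq_iff indicator_def fourier_bump)
  ultimately show "integrable lborel (\<lambda>\<omega>. (norm (fourier (bump x) \<omega>))\<^sup>2)"
    by (simp add: set_integrable_def)
qed

lemma bump_in_paley_wiener: "bump x \<in> paley_wiener {-1/2..1/2}"
proof -
  \<comment> \<open>Since \<open>bump x\<close> is itself integrable, the constant sequence is an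
    admissible approximation.\<close>
  have "L2_fourier (bump x) (fourier (bump x))"
    unfolding L2_fourier_def
    using square_integrable_bump square_integrable_fourier_bump integrable_bump
    by (auto intro!: exI[of _ "\<lambda>_. bump x"])
  moreover have "ae_support (fourier (bump x)) \<subseteq> {-1/2..1/2}"
    unfolding ae_support_def
  proof
    fix \<omega> :: real
    assume "\<omega> \<in> - \<Union>{U. open U \<and> (AE x' in lborel. x' \<in> U \<longrightarrow> fourier (bump x) x' = 0)}"
    \<comment> \<open>The complement of the band is one of the open sets removed in
      \<open>ae_support\<close>.\<close>
    moreover have "open (- {-1/2..1/2::real})" by (intro open_Compl closed_atLeastAtMost)
    moreover have "AE x' in lborel. x' \<in> - {-1/2..1/2} \<longrightarrow> fourier (bump x) x' = 0"
      using bump_hat_eq_0 by (intro AE_I2) (simp add: fourier_bump)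
    ultimately show "\<omega> \<in> {-1/2..1/2}" by blast
  qed
  ultimately show ?thesis
    unfolding paley_wiener_def
    using continuous_on_bump square_integrable_bump by blast
qed

text \<open>By continuity, a function that is not identically 0 is nonzero on a nonempty open set,
  which is not a null set.\<close>

lemma L2_fun_norm_pos:
  assumes "continuous_on UNIV s" "square_integrable s" "s \<noteq> (\<lambda>_. 0)"
  shows "0 < L2_fun_norm s"
proof (rule ccontr)
  let ?U = "{x. s x \<noteq> 0}"
  assume "\<not> 0 < L2_fun_norm s"
  then have "(LINT x|lborel. (norm (s x))\<^sup>2) = 0"
    unfolding L2_fun_norm_def by (simp add: antisym)
  then have "AE x in lborel. (norm (s x))\<^sup>2 = 0"
    using assms(2) by (subst (asm) integral_nonneg_eq_0_iff_AE) (auto simp: square_integrable_def)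
  then have "AE x in lborel. x \<notin> ?U" by simp
  moreover have U: "open ?U"
    using open_vimage[OF open_delete[OF open_UNIV, of 0] assms(1)] by (simp add: vimage_def)
  ultimately have "?U \<in> null_sets lebesgue"
    by (metis AE_iff_null_sets borel_open null_sets_completionI sets_lborel)
  then show False
    using open_not_negligible[OF U] assms(3) by (auto simp: negligible_iff_null_sets)
qed

text \<open>Frees the norm from the centre, which will depend on the outcome \<omega>.\<close>

lemma L2_fun_norm_bump: "L2_fun_norm (bump x) = L2_fun_norm (bump 0)"
  unfolding L2_fun_norm_def
  by (subst lborel_integral_real_affine[of 1 _ x]) (simp_all add: bump_def)

lemma bump_neq_0: "bump x \<noteq> (\<lambda>_. 0)"
proof -
  have "bump x x \<noteq> 0" by (simp add: bump_def)
  then show ?thesis by auto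
qed

section \<open>Sums of squared samples\<close>

lemma summable_on_int_inverse_squares:
  "(\<lambda>n::int. 1 / (1 + \<bar>of_int n\<bar>)\<^sup>2 :: real) summable_on UNIV"
proof -
  let ?f = "\<lambda>n::int. 1 / (1 + \<bar>of_int n\<bar>)\<^sup>2 :: real"
  have "summable (\<lambda>n::nat. 1 / (1 + real n)\<^sup>2)"
    using sums_summable[OF inverse_squares_sums] by (simp add: add.commute)
  then have s: "(\<lambda>n::nat. 1 / (1 + real n)\<^sup>2) summable_on UNIV"
    by (intro norm_summable_imp_summable_on) simp
  have "?f summable_on range int"
    by (subst summable_on_reindex) (simp_all add: o_def s)
  moreover have "?f summable_on range (\<lambda>n. - int n)"
    by (subst summable_on_reindex) (simp_all add: o_def s inj_on_def)
  ultimately have "?f summable_on (range int \<union> range (\<lambda>n. - int n))"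
    by (rule summable_on_union)
  moreover have "range int \<union> range (\<lambda>n. - int n) = UNIV"
  proof -
    have "n \<in> range int \<union> range (\<lambda>n. - int n)" for n
      by (cases n rule: int_cases2) auto
    then show ?thesis by blast
  qed
  ultimately show ?thesis by simp
qed

lemma bump_samples:
  fixes \<tau> :: "int \<Rightarrow> real"
  assumes R: "1 \<le> R" and gap: "\<And>n. (\<bar>of_int (n - m)\<bar> + R) / 4 \<le> \<bar>\<tau> n - x\<bar>"
  shows "(\<lambda>n. (norm (bump x (\<tau> n)))\<^sup>2) summable_on UNIV"
    and "(\<Sum>\<^sub>\<infinity>n. (norm (bump x (\<tau> n)))\<^sup>2) \<le>
           256 / R\<^sup>2 * (\<Sum>\<^sub>\<infinity>n::int. 1 / (1 + \<bar>of_int n\<bar>)\<^sup>2)"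
proof -
  let ?g = "\<lambda>n::int. 1 / (1 + \<bar>of_int n\<bar>)\<^sup>2 :: real"
  let ?h = "\<lambda>n::int. 256 / R\<^sup>2 * ?g (n - m)"
  have bij: "bij_betw (\<lambda>n::int. n - m) UNIV UNIV"
    by (rule bij_betwI[where g = "\<lambda>n. n + m"]) auto
  have "(\<lambda>n. ?g (n - m)) summable_on UNIV"
    using summable_on_reindex_bij_betw[OF bij, of ?g] summable_on_int_inverse_squares by simp
  then have h: "?h summable_on UNIV"
    by (rule summable_on_cmult_right)
  have le: "(norm (bump x (\<tau> n)))\<^sup>2 \<le> ?h n" for n
  proof -
    let ?d = "\<bar>of_int (n - m)\<bar> :: real"
    have pos: "0 < (?d + R) / 4" using R by simp
    then have "\<tau> n \<noteq> x" using gap[of n] by auto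
    then have "norm (bump x (\<tau> n)) \<le> 1 / \<bar>\<tau> n - x\<bar>\<^sup>2"
      using norm_bump_le[of "\<tau> n" x] by simp
    also have "\<dots> \<le> 1 / ((?d + R) / 4)\<^sup>2"
      using pos gap[of n] by (intro divide_left_mono power_mono mult_pos_pos zero_less_power) auto
    also have "\<dots> = 16 / ((?d + R) * (?d + R))"
      by (simp add: power2_eq_square)
    \<comment> \<open>Of the two factors d + R, one is bounded below by R, for smallness, and the
      other by 1 + d, for summability; squaring then yields 256 / R^2.\<close>
    also have "\<dots> \<le> 16 / (R * (1 + ?d))"
      using R by (intro divide_left_mono mult_mono mult_pos_pos) auto
    finally have "(norm (bump x (\<tau> n)))\<^sup>2 \<le> (16 / (R * (1 + ?d)))\<^sup>2"
      by (rule power_mono) simp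
    also have "\<dots> = ?h n"
      by (simp add: power_divide power_mult_distrib)
    finally show ?thesis .
  qed
  show s: "(\<lambda>n. (norm (bump x (\<tau> n)))\<^sup>2) summable_on UNIV"
    by (rule summable_on_comparison_test[OF h]) (use le in auto)
  have "(\<Sum>\<^sub>\<infinity>n. (norm (bump x (\<tau> n)))\<^sup>2) \<le> (\<Sum>\<^sub>\<infinity>n. ?h n)"
    by (rule infsum_mono[OF s h]) (rule le)
  also have "\<dots> = 256 / R\<^sup>2 * (\<Sum>\<^sub>\<infinity>n. ?g (n - m))"
    by (rule infsum_cmult_right')
  also have "(\<Sum>\<^sub>\<infinity>n. ?g (n - m)) = (\<Sum>\<^sub>\<infinity>n. ?g n)"
    using infsum_reindex_bij_betw[OF bij, of ?g] by simp
  finally show "(\<Sum>\<^sub>\<infinity>n. (norm (bump x (\<tau> n)))\<^sup>2) \<le> 256 / R\<^sup>2 * (\<Sum>\<^sub>\<infinity>n. ?g n)" .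
qed

subsection \<open>Gaps produced by a run of large innovations\<close>

text \<open>\<open>D\<close> bounds what the innovations outside the run \<open>{0..N}\<close> can contribute to a process
  value inside it; the centre of the gap is \<open>R / 2\<close>.\<close>

lemma AR1_gap:
  fixes e :: "int \<Rightarrow> real"
  assumes \<phi>: "0 < \<phi>" "\<phi> < 1"
    and c: "c = (1 - \<phi>) / 4" and A: "0 \<le> A"
    and D: "D = (\<Sum>k. \<phi> ^ k * (A + c * real k))"
    and R: "4 * D \<le> R" "2 * R \<le> real N"
    and block: "\<And>j. j \<in> {0..int N} \<Longrightarrow> R + D \<le> e j"
    and past: "\<And>i::nat. \<bar>e (- 1 - int i)\<bar> \<le> A + c * real i"
    and future: "\<And>i::nat. \<bar>e (int N + 1 + int i)\<bar> \<le> A + c * real i"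
  shows "(\<bar>of_int n\<bar> + R) / 4 \<le> \<bar>of_int n + (\<Sum>k. \<phi> ^ k * e (n - int k)) - R / 2\<bar>"
proof -
  have c0: "0 < c" using \<phi> by (simp add: c)
  have sg: "summable (\<lambda>k. \<phi> ^ k)" "(\<Sum>k. \<phi> ^ k) = 1 / (1 - \<phi>)"
    using \<phi> by (simp_all add: summable_geometric suminf_geometric)
  \<comment> \<open>The weights k \<phi>^k are obtained as (k + 1) \<phi>^k - \<phi>^k, from the
    differentiated geometric series.\<close>
  have "summable (\<lambda>k. real (Suc k) * \<phi> ^ k)"
    using geometric_deriv_sums[of \<phi>] \<phi> by (simp add: sums_iff)
  then have "summable (\<lambda>k. real (Suc k) * \<phi> ^ k - \<phi> ^ k)"
    by (intro summable_diff sg)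
  then have "summable (\<lambda>k. A * \<phi> ^ k + c * (real (Suc k) * \<phi> ^ k - \<phi> ^ k))"
    by (intro summable_add summable_mult sg)
  then have sD: "summable (\<lambda>k. \<phi> ^ k * (A + c * real k))"
    by (simp add: algebra_simps)
  have D0: "0 \<le> D"
    unfolding D using \<phi> A c0 by (intro suminf_nonneg sD) simp
  have sDB: "summable (\<lambda>k. \<phi> ^ k * (A + c * real k + B))"
    and vDB: "(\<Sum>k. \<phi> ^ k * (A + c * real k + B)) = D + B / (1 - \<phi>)" for B
  proof -
    have eq: "(\<lambda>k. \<phi> ^ k * (A + c * real k + B)) = (\<lambda>k. \<phi> ^ k * (A + c * real k) + \<phi> ^ k * B)"
      by (simp add: algebra_simps)
    show "summable (\<lambda>k. \<phi> ^ k * (A + c * real k + B))"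
      unfolding eq by (intro summable_add sD summable_mult2 sg)
    show "(\<Sum>k. \<phi> ^ k * (A + c * real k + B)) = D + B / (1 - \<phi>)"
      unfolding eq D using suminf_add[OF sD summable_mult2[OF sg(1), of B]]
        suminf_mult2[OF sg(1), of B] sg(2) by simp
  qed
  have neg: "\<bar>e j\<bar> \<le> A + c * \<bar>of_int j\<bar>" if "j < 0" for j
  proof -
    have "\<bar>e j\<bar> \<le> A + c * real (nat (- j - 1))"
      using past[of "nat (- j - 1)"] that by simp
    also have "\<dots> \<le> A + c * \<bar>of_int j\<bar>"
      using that c0 by (intro add_left_mono mult_left_mono) auto
    finally show ?thesis .
  qed
  have pos: "\<bar>e j\<bar> \<le> A + c * \<bar>of_int j\<bar>" if "int N < j" for j
  proof -
    have "\<bar>e j\<bar> \<le> A + c * real (nat (j - int N - 1))"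
      using future[of "nat (j - int N - 1)"] that by simp
    also have "\<dots> \<le> A + c * \<bar>of_int j\<bar>"
      using that c0 by (intro add_left_mono mult_left_mono) auto
    finally show ?thesis .
  qed
  have R0: "0 \<le> R" using R D0 by simp
  \<comment> \<open>Only a lower bound is available for every index, since innovations in the run
    may be arbitrarily large.\<close>
  have lower: "- (A + c * \<bar>of_int j\<bar>) \<le> e j" for j
  proof (cases "j \<in> {0..int N}")
    case True
    have "0 \<le> c * \<bar>of_int j :: real\<bar>" using c0 by simp
    then show ?thesis using block[OF True] R0 D0 A by linarith
  next
    case False
    then show ?thesis using neg[of j] pos[of j] by force
  qed
  have tri: "c * \<bar>of_int (n - int k)\<bar> \<le> c * real k + c * \<bar>of_int n\<bar>" for k
  proof -
    have "c * \<bar>of_int (n - int k)\<bar> \<le> c * (real k + \<bar>of_int n\<bar>)"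
      using c0 by (intro mult_left_mono) auto
    then show ?thesis by (simp add: algebra_simps)
  qed
  define B where "B = c * \<bar>of_int n\<bar>"
  \<comment> \<open>The choice of c makes the growth term cost exactly |n|/4 after summation, so
    that it cannot cancel the drift n.\<close>
  have B: "B / (1 - \<phi>) = \<bar>of_int n\<bar> / 4"
    using \<phi> by (simp add: B_def c field_simps)
  have se: "summable (\<lambda>k. \<phi> ^ k * e (n - int k))"
  proof (rule summable_comparison_test_ev)
    show "summable (\<lambda>k. \<phi> ^ k * (A + c * real k + B))" by (rule sDB)
    \<comment> \<open>From k = n + 1 on, only innovations before the run occur; the finitely many
      earlier terms do not affect convergence.\<close>
    show "\<forall>\<^sub>F k in sequentially. norm (\<phi> ^ k * e (n - int k)) \<le> \<phi> ^ k * (A + c * real k + B)"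
    proof (rule eventually_sequentiallyI)
      fix k assume "nat (n + 1) \<le> k"
      then have "n - int k < 0" by linarith
      then have "\<bar>e (n - int k)\<bar> \<le> A + c * real k + B"
        using neg[of "n - int k"] tri[of k] by (simp add: B_def)
      then show "norm (\<phi> ^ k * e (n - int k)) \<le> \<phi> ^ k * (A + c * real k + B)"
        using \<phi> by (simp add: abs_mult)
    qed
  qed
  define \<xi> where "\<xi> = (\<Sum>k. \<phi> ^ k * e (n - int k))"
  have \<xi>_ge: "- (D + \<bar>of_int n\<bar> / 4) \<le> \<xi>"
  proof -
    have "(\<Sum>k. - (\<phi> ^ k * (A + c * real k + B))) \<le> \<xi>"
      unfolding \<xi>_def
    proof (intro suminf_le summable_minus sDB se)
      fix k
      have "- (A + c * real k + B) \<le> e (n - int k)"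
        using lower[of "n - int k"] tri[of k] by (simp add: B_def)
      then have "\<phi> ^ k * - (A + c * real k + B) \<le> \<phi> ^ k * e (n - int k)"
        using \<phi> by (intro mult_left_mono) auto
      then show "- (\<phi> ^ k * (A + c * real k + B)) \<le> \<phi> ^ k * e (n - int k)"
        by (simp only: mult_minus_right)
    qed
    then show ?thesis
      by (simp only: suminf_minus[OF sDB] vDB B)
  qed
  consider (neg) "n < 0" | (block) "n \<in> {0..int N}" | (pos) "int N < n" by force
  then show ?thesis
  proof cases
    case neg
    \<comment> \<open>Points before the run see only earlier innovations. Hence n + \<xi> - R/2
      \<le> -3|n|/4 + D - R/2, and D \<le> R/4 gives the left side of the gap.\<close>
    have "\<xi> \<le> (\<Sum>k. \<phi> ^ k * (A + c * real k + B))"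
      unfolding \<xi>_def
    proof (intro suminf_le sDB se)
      fix k
      have "n - int k < 0" using neg by simp
      then have "e (n - int k) \<le> A + c * real k + B"
        using \<open>\<And>j. j < 0 \<Longrightarrow> \<bar>e j\<bar> \<le> A + c * \<bar>of_int j\<bar>\<close>[of "n - int k"] tri[of k] by (simp add: B_def)
      then show "\<phi> ^ k * e (n - int k) \<le> \<phi> ^ k * (A + c * real k + B)"
        using \<phi> by (intro mult_left_mono) auto
    qed
    then have "\<xi> \<le> D + \<bar>of_int n\<bar> / 4" by (simp only: vDB B)
    moreover have "\<bar>of_int n :: real\<bar> = - of_int n" "(of_int n :: real) < 0" using neg by simp_all
    ultimately have "(\<bar>of_int n\<bar> + R) / 4 \<le> - (of_int n + \<xi> - R / 2)"
      using R D0 by (simp add: field_simps)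
    then show ?thesis unfolding \<xi>_def[symmetric] by linarith
  next
    case pos
    \<comment> \<open>Beyond the run, n + \<xi> - R/2 \<ge> 3n/4 - 3R/4, which is at least (n + R)/4
      because n > N \<ge> 2R: the run is long enough for the drift to take over.\<close>
    have "real N < of_int n" "\<bar>of_int n :: real\<bar> = of_int n" using pos by linarith+
    then have "(\<bar>of_int n\<bar> + R) / 4 \<le> of_int n + \<xi> - R / 2"
      using \<xi>_ge R D0 by (simp add: field_simps)
    then show ?thesis unfolding \<xi>_def[symmetric] by linarith
  next
    case block
    \<comment> \<open>Inside the run the term k = 0 contributes R + D and the other terms from the
      run are nonnegative. Indices before the run have modulus at most k, as n \<ge> 0, so together
      they cost at most D, with no term in |n|.\<close>
    have "R + D + (\<Sum>k. - (\<phi> ^ k * (A + c * real k))) \<le> \<xi>"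
    proof -
      have s1: "(\<lambda>k. if k = 0 then R + D else 0) sums (R + D)"
        using sums_single[of 0 "\<lambda>_. R + D"] by simp
      have "(\<Sum>k. (if k = 0 then R + D else 0) + - (\<phi> ^ k * (A + c * real k))) \<le> \<xi>"
        unfolding \<xi>_def
      proof (intro suminf_le summable_add sums_summable[OF s1] summable_minus sD se)
        fix k :: nat
        have Ak: "0 \<le> A + c * real k" using A c0 by simp
        then have pk: "0 \<le> \<phi> ^ k * (A + c * real k)" using \<phi> by simp
        show "(if k = 0 then R + D else 0) + - (\<phi> ^ k * (A + c * real k)) \<le> \<phi> ^ k * e (n - int k)"
        proof (cases "n - int k < 0")
          case True
          then have k: "k \<noteq> 0" using block by auto
          have "\<bar>of_int (n - int k)\<bar> \<le> real k" using True block by auto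
          then have "c * \<bar>of_int (n - int k)\<bar> \<le> c * real k"
            using c0 by (intro mult_left_mono) auto
          then have "- (A + c * real k) \<le> e (n - int k)"
            using lower[of "n - int k"] by linarith
          then have "\<phi> ^ k * - (A + c * real k) \<le> \<phi> ^ k * e (n - int k)"
            using \<phi> by (intro mult_left_mono) auto
          then show ?thesis by (simp only: k if_False mult_minus_right add_0_left)
        next
          case False
          then have "n - int k \<in> {0..int N}" using block by auto
          then have e: "R + D \<le> e (n - int k)" by (rule assms(8))
          then have "0 \<le> \<phi> ^ k * e (n - int k)" using \<phi> R0 D0 by simp
          then show ?thesis using e pk A by (cases "k = 0") auto
        qed
      qed
      then show ?thesis
        using suminf_add[OF sums_summable[OF s1] summable_minus[OF sD]] s1 by (simp add: sums_iff)
    qed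
    then have "R \<le> \<xi>" by (simp add: suminf_minus[OF sD] D)
    moreover have "0 \<le> (of_int n :: real)" using block by simp
    ultimately have "(\<bar>of_int n\<bar> + R) / 4 \<le> of_int n + \<xi> - R / 2"
      using R0 by (simp add: field_simps)
    then show ?thesis unfolding \<xi>_def[symmetric] by linarith
  qed
qed

subsection \<open>Independent windows\<close>

text \<open>The exceptional sets for \<eta> = 1/(k + 1) intersect in a null set that contains every
  failure, so the set of failures itself is never shown to be measurable.\<close>

lemma (in finite_measure) AE_I_small_exceptions:
  assumes "\<And>\<eta>. 0 < \<eta> \<Longrightarrow> \<exists>B\<in>sets M. measure M B \<le> \<eta> \<and> (\<forall>\<omega>\<in>space M - B. P \<omega>)"
  shows "AE \<omega> in M. P \<omega>"
proof -
  have "\<exists>B. B \<in> sets M \<and> measure M B \<le> 1 / real (Suc k) \<and> (\<forall>\<omega>\<in>space M - B. P \<omega>)" for k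
    using assms[of "1 / real (Suc k)"] by auto
  then obtain B where B: "\<And>k. B k \<in> sets M" "\<And>k. measure M (B k) \<le> 1 / real (Suc k)"
      "\<And>k \<omega>. \<omega> \<in> space M - B k \<Longrightarrow> P \<omega>"
    by metis
  have sets: "(\<Inter>k. B k) \<in> sets M" using B(1) by auto
  have "measure M (\<Inter>k. B k) \<le> 1 / real (Suc k)" for k
    using finite_measure_mono[of "\<Inter>k. B k" "B k"] B(1,2)[of k] by fastforce
  then have "measure M (\<Inter>k. B k) \<le> 0"
    by (intro LIMSEQ_le_const[OF LIMSEQ_Suc[OF lim_1_over_n]]) auto
  then have "(\<Inter>k. B k) \<in> null_sets M"
    using sets by (intro null_setsI) (auto simp: emeasure_eq_measure antisym)
  then show ?thesis
    by (rule AE_I') (use B(3) in auto)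
qed

context prob_space
begin

section \<open>Gaussian tails and independent blocks\<close>

lemma distributed_normal_prob_ge_pos:
  assumes X: "distributed M lborel X (normal_density 0 \<sigma>)" and \<sigma>: "0 < \<sigma>"
  shows "0 < prob {\<omega>\<in>space M. S \<le> X \<omega>}"
proof -
  have eq: "{\<omega>\<in>space M. S \<le> X \<omega>} = X -` {S..} \<inter> space M" by auto
  have "emeasure M (X -` {S..} \<inter> space M) = (\<integral>\<^sup>+x. ennreal (normal_density 0 \<sigma> x) * indicator {S..} x \<partial>lborel)"
    by (rule distributed_emeasure[OF X]) simp
  moreover have "\<dots> \<noteq> 0"
  proof
    assume "(\<integral>\<^sup>+x. ennreal (normal_density 0 \<sigma> x) * indicator {S..} x \<partial>lborel) = 0"
    \<comment> \<open>As the density is positive everywhere, a vanishing integral would make the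
      half-line a null set.\<close>
    then have "AE x in lborel. ennreal (normal_density 0 \<sigma> x) * indicator {S..} x = 0"
      by (subst (asm) nn_integral_0_iff_AE) auto
    then have "AE x in lborel. x \<notin> {S..}"
    proof eventually_elim
      case (elim x)
      then show ?case
        using normal_density_pos[OF \<sigma>, of 0 x] by (cases "x \<in> {S..}") simp_all
    qed
    then have "emeasure lborel {S..} = 0"
      by (subst (asm) AE_iff_null_sets[symmetric]) auto
    moreover have "emeasure lborel {S..S + 1} \<le> emeasure lborel {S..}"
      by (intro emeasure_mono) auto
    ultimately show False by simp
  qed
  ultimately show ?thesis
    unfolding eq by (metis emeasure_eq_measure ennreal_0 zero_less_measure_iff)
qed

text \<open>Markov's inequality for the fourth moment 3 \<sigma>^4. With a = A + c i, two powers
  will serve summability in i and two decay in A.\<close>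

lemma distributed_normal_tail:
  assumes X: "distributed M lborel X (normal_density 0 \<sigma>)" and \<sigma>: "0 < \<sigma>" and a: "0 < a"
  shows "prob {\<omega>\<in>space M. a < \<bar>X \<omega>\<bar>} \<le> 3 * \<sigma> ^ 4 / a ^ 4"
proof -
  have rv [measurable]: "random_variable borel X"
    using distributed_measurable[OF X] by simp
  have int: "integrable M (\<lambda>\<omega>. (X \<omega>) ^ 4)"
    using integrable_normal_moment[OF \<sigma>, of 0 4] distributed_integrable[OF X, of "\<lambda>x. x ^ 4"]
    by (simp add: normal_density_nonneg)
  have "expectation (\<lambda>\<omega>. (X \<omega>) ^ 4) = (\<integral>x. normal_density 0 \<sigma> x * x ^ 4 \<partial>lborel)"
    by (rule distributed_integral[OF X, symmetric]) (auto simp: normal_density_nonneg)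
  also have "\<dots> = 3 * \<sigma> ^ 4"
    using integral_normal_moment_even[OF \<sigma>, of 0 2] by (simp add: fact_numeral power_divide field_simps)
  finally have "expectation (\<lambda>\<omega>. (X \<omega>) ^ 4) = 3 * \<sigma> ^ 4" .
  moreover have "prob {\<omega>\<in>space M. a ^ 4 \<le> (X \<omega>) ^ 4} \<le> expectation (\<lambda>\<omega>. (X \<omega>) ^ 4) / a ^ 4"
    using a by (intro integral_Markov_inequality_measure[OF int, of "{}"]) auto
  moreover have "prob {\<omega>\<in>space M. a < \<bar>X \<omega>\<bar>} \<le> prob {\<omega>\<in>space M. a ^ 4 \<le> (X \<omega>) ^ 4}"
  proof (rule finite_measure_mono)
    show "{\<omega>\<in>space M. a < \<bar>X \<omega>\<bar>} \<subseteq> {\<omega>\<in>space M. a ^ 4 \<le> (X \<omega>) ^ 4}"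
    proof safe
      fix \<omega> assume "a < \<bar>X \<omega>\<bar>"
      then have "a ^ 4 \<le> \<bar>X \<omega>\<bar> ^ 4" using a by (intro power_mono) auto
      then show "a ^ 4 \<le> (X \<omega>) ^ 4" by (simp add: power_even_abs)
    qed
  qed measurable
  ultimately show ?thesis by simp
qed

text \<open>The factor q^|J| in the second part makes a bad neighbour rare relative to the run
  itself, so the sum over about K/p windows stays bounded however small p is.\<close>

lemma indep_vars_block:
  fixes X :: "'i \<Rightarrow> 'a \<Rightarrow> real"
  assumes X: "indep_vars (\<lambda>_. borel) X UNIV" and J: "finite J" "k \<notin> J"
    and q: "\<And>j. prob {\<omega>\<in>space M. S \<le> X j \<omega>} = q"
  shows "prob {\<omega>\<in>space M. \<forall>j\<in>J. S \<le> X j \<omega>} = q ^ card J"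
    and "prob {\<omega>\<in>space M. (\<forall>j\<in>J. S \<le> X j \<omega>) \<and> a < \<bar>X k \<omega>\<bar>} =
           q ^ card J * prob {\<omega>\<in>space M. a < \<bar>X k \<omega>\<bar>}"
proof -
  have vim: "X j -` {S..} \<inter> space M = {\<omega>\<in>space M. S \<le> X j \<omega>}" for j by auto
  show "prob {\<omega>\<in>space M. \<forall>j\<in>J. S \<le> X j \<omega>} = q ^ card J"
  proof (cases "J = {}")
    case False
    have "prob (\<Inter>j\<in>J. X j -` {S..} \<inter> space M) = (\<Prod>j\<in>J. prob (X j -` {S..} \<inter> space M))"
      using False J by (intro indep_varsD[OF X]) auto
    moreover have "(\<Inter>j\<in>J. X j -` {S..} \<inter> space M) = {\<omega>\<in>space M. \<forall>j\<in>J. S \<le> X j \<omega>}"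
      using False by auto
    ultimately show ?thesis by (simp add: vim q)
  qed (simp add: prob_space)
  let ?A = "\<lambda>j. if j = k then {x. a < \<bar>x\<bar>} else {S..}"
  have "{\<omega>\<in>space M. (\<forall>j\<in>J. S \<le> X j \<omega>) \<and> a < \<bar>X k \<omega>\<bar>} =
      (\<Inter>j\<in>insert k J. X j -` ?A j \<inter> space M)"
    using J by (auto split: if_splits)
  also have "prob \<dots> = (\<Prod>j\<in>insert k J. prob (X j -` ?A j \<inter> space M))"
    using J by (intro indep_varsD[OF X]) auto
  also have "\<dots> = prob (X k -` ?A k \<inter> space M) * (\<Prod>j\<in>J. prob (X j -` ?A j \<inter> space M))"
    by (rule prod.insert) (use J in auto)
  also have "(\<Prod>j\<in>J. prob (X j -` ?A j \<inter> space M)) = (\<Prod>j\<in>J. q)"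
  proof (rule prod.cong[OF refl])
    fix j assume "j \<in> J"
    then have "j \<noteq> k" using J by auto
    then show "prob (X j -` ?A j \<inter> space M) = q" by (simp only: if_False vim q)
  qed
  also have "X k -` ?A k \<inter> space M = {\<omega>\<in>space M. a < \<bar>X k \<omega>\<bar>}" by auto
  finally show "prob {\<omega>\<in>space M. (\<forall>j\<in>J. S \<le> X j \<omega>) \<and> a < \<bar>X k \<omega>\<bar>} =
      q ^ card J * prob {\<omega>\<in>space M. a < \<bar>X k \<omega>\<bar>}"
    by (simp only: prod_constant mult.commute)
qed

text \<open>Families of variables over disjoint index sets are independent, hence so are the
  failures of the different windows.\<close>

lemma indep_vars_no_block:
  fixes X :: "'i \<Rightarrow> 'a \<Rightarrow> real" and J :: "nat \<Rightarrow> 'i set"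
  assumes X: "indep_vars (\<lambda>_. borel) X UNIV"
    and J: "\<And>i. finite (J i)" "disjoint_family J"
    and p: "\<And>i. prob {\<omega>\<in>space M. \<forall>j\<in>J i. S \<le> X j \<omega>} = p"
  shows "prob {\<omega>\<in>space M. \<forall>i<r. \<not> (\<forall>j\<in>J i. S \<le> X j \<omega>)} \<le> (1 - p) ^ r"
proof (cases "r = 0")
  case False
  have rv [measurable]: "random_variable borel (X j)" for j
    using X by (auto simp: indep_vars_def)
  let ?Y = "\<lambda>i f. \<forall>j\<in>J i. S \<le> f j"
  have meas: "?Y i \<in> measurable (\<Pi>\<^sub>M j\<in>J i. borel) (count_space UNIV)" for i
  proof (intro pred_intros_finite(3) J(1))
    fix j assume "j \<in> J i"
    then have [measurable]: "(\<lambda>f. f j) \<in> borel_measurable (\<Pi>\<^sub>M j\<in>J i. borel)"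
      by (rule measurable_component_singleton)
    then show "Measurable.pred (\<Pi>\<^sub>M j\<in>J i. borel) (\<lambda>f. S \<le> f j)"
      by measurable
  qed
  have "indep_vars (\<lambda>i. \<Pi>\<^sub>M j\<in>J i. borel) (\<lambda>i \<omega>. restrict (\<lambda>j. X j \<omega>) (J i)) UNIV"
    using J by (intro indep_vars_restrict[OF X]) auto
  then have "indep_vars (\<lambda>_. count_space UNIV) (\<lambda>i \<omega>. ?Y i (restrict (\<lambda>j. X j \<omega>) (J i))) UNIV"
    by (rule indep_vars_compose2) (rule meas)
  then have "indep_vars (\<lambda>_. count_space UNIV) (\<lambda>i \<omega>. ?Y i (\<lambda>j. X j \<omega>)) UNIV"
    by simp
  then have "prob (\<Inter>i\<in>{..<r}. (\<lambda>\<omega>. ?Y i (\<lambda>j. X j \<omega>)) -` {False} \<inter> space M) =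
      (\<Prod>i\<in>{..<r}. prob ((\<lambda>\<omega>. ?Y i (\<lambda>j. X j \<omega>)) -` {False} \<inter> space M))"
    using False by (intro indep_varsD) auto
  moreover have "(\<Inter>i\<in>{..<r}. (\<lambda>\<omega>. ?Y i (\<lambda>j. X j \<omega>)) -` {False} \<inter> space M) =
      {\<omega>\<in>space M. \<forall>i<r. \<not> ?Y i (\<lambda>j. X j \<omega>)}"
    using False by auto
  moreover have "prob ((\<lambda>\<omega>. ?Y i (\<lambda>j. X j \<omega>)) -` {False} \<inter> space M) = 1 - p" for i
  proof -
    have "{\<omega>\<in>space M. ?Y i (\<lambda>j. X j \<omega>)} \<in> events"
      by (intro sets.sets_Collect_finite_All J(1)) measurable
    from prob_compl[OF this]
    have "prob (space M - {\<omega>\<in>space M. ?Y i (\<lambda>j. X j \<omega>)}) = 1 - p"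
      by (simp only: p)
    also have "space M - {\<omega>\<in>space M. ?Y i (\<lambda>j. X j \<omega>)} =
        (\<lambda>\<omega>. ?Y i (\<lambda>j. X j \<omega>)) -` {False} \<inter> space M"
      by auto
    finally show ?thesis .
  qed
  ultimately show ?thesis by simp
qed simp

lemma indep_vars_block_events:
  fixes X :: "'i \<Rightarrow> 'a \<Rightarrow> real"
  assumes X: "indep_vars (\<lambda>_. borel) X UNIV" and J: "finite J"
  shows "{\<omega>\<in>space M. \<forall>j\<in>J. S \<le> X j \<omega>} \<in> events"
proof -
  have [measurable]: "random_variable borel (X j)" for j
    using X by (auto simp: indep_vars_def)
  show ?thesis
    by (intro sets.sets_Collect_finite_All J) measurable
qed

text \<open>A countable union bound over the place of the violation; each term factorises because
  that place lies outside the run.\<close>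

lemma indep_vars_block_tail:
  fixes X :: "'i \<Rightarrow> 'a \<Rightarrow> real" and \<kappa> :: "nat \<Rightarrow> 'i"
  assumes X: "indep_vars (\<lambda>_. borel) X UNIV" and J: "finite J" "\<And>i. \<kappa> i \<notin> J"
    and q: "\<And>j. prob {\<omega>\<in>space M. S \<le> X j \<omega>} = q"
    and b: "\<And>i. prob {\<omega>\<in>space M. a i < \<bar>X (\<kappa> i) \<omega>\<bar>} \<le> b i" "summable b"
  shows "{\<omega>\<in>space M. (\<forall>j\<in>J. S \<le> X j \<omega>) \<and> (\<exists>i. a i < \<bar>X (\<kappa> i) \<omega>\<bar>)} \<in> events" (is "?E \<in> _")
    and "prob {\<omega>\<in>space M. (\<forall>j\<in>J. S \<le> X j \<omega>) \<and> (\<exists>i. a i < \<bar>X (\<kappa> i) \<omega>\<bar>)} \<le> q ^ card J * suminf b"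
proof -
  let ?F = "\<lambda>i. {\<omega>\<in>space M. (\<forall>j\<in>J. S \<le> X j \<omega>) \<and> a i < \<bar>X (\<kappa> i) \<omega>\<bar>}"
  have [measurable]: "random_variable borel (X j)" for j
    using X by (auto simp: indep_vars_def)
  have F: "?F i \<in> events" for i
    by (intro sets.sets_Collect_conj indep_vars_block_events[OF X] J) measurable
  have eq: "?E = (\<Union>i. ?F i)" by auto
  show "?E \<in> events"
    unfolding eq using F by auto
  have q0: "0 \<le> q" using q[of undefined] measure_nonneg by metis
  have le: "prob (?F i) \<le> q ^ card J * b i" for i
    unfolding indep_vars_block(2)[OF X J(1) J(2) q]
    by (intro mult_left_mono b) (simp add: q0)
  have sb: "summable (\<lambda>i. q ^ card J * b i)"
    by (intro summable_mult b)
  have sF: "summable (\<lambda>i. prob (?F i))"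
    by (rule summable_comparison_test'[OF sb]) (use le in simp)
  have "prob ?E \<le> (\<Sum>i. prob (?F i))"
    unfolding eq using F sF by (intro finite_measure_subadditive_countably) auto
  also have "\<dots> \<le> (\<Sum>i. q ^ card J * b i)"
    by (rule suminf_le[OF le sF sb])
  also have "\<dots> = q ^ card J * suminf b"
    by (rule suminf_mult[OF b(2)])
  finally show "prob ?E \<le> q ^ card J * suminf b" .
qed

text \<open>The quantifier order matters: \<open>A\<close> may not depend on the height \<open>S\<close> and length \<open>N\<close> of
  the run, which are later chosen in terms of \<open>A\<close>.\<close>

lemma normal_block_with_small_surroundings:
  fixes X :: "int \<Rightarrow> 'a \<Rightarrow> real"
  assumes X: "indep_vars (\<lambda>_. borel) X UNIV"
    and normal: "\<And>n. distributed M lborel (X n) (normal_density 0 \<sigma>)"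
    and pos: "0 < \<sigma>" "0 < c" "0 < \<eta>"
  shows "\<exists>A>0. \<forall>S N. \<exists>B\<in>events. prob B \<le> \<eta> \<and>
    (\<forall>\<omega>\<in>space M - B. \<exists>m. (\<forall>j\<in>{m..m + int N}. S \<le> X j \<omega>) \<and>
       (\<forall>i::nat. \<bar>X (m - 1 - int i) \<omega>\<bar> \<le> A + c * real i) \<and>
       (\<forall>i::nat. \<bar>X (m + int N + 1 + int i) \<omega>\<bar> \<le> A + c * real i))"
proof -
  \<comment> \<open>K is the expected number of runs aimed at, with e^(-K) \<le> \<eta>/2; the
    maximum keeps it nonnegative when \<eta> > 2.\<close>
  define K where "K = max 0 (ln (2 / \<eta>))"
  have K: "0 \<le> K" "exp (- K) \<le> \<eta> / 2"
  proof -
    have "exp (- K) \<le> exp (- ln (2 / \<eta>))" by (simp add: K_def)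
    also have "\<dots> = \<eta> / 2" using pos by (simp add: exp_minus)
    finally show "exp (- K) \<le> \<eta> / 2" .
  qed (simp add: K_def)
  define \<delta> where "\<delta> = \<eta> / 2 / (K + 1)"
  have \<delta>: "0 < \<delta>" using pos K by (simp add: \<delta>_def)
  define Z where "Z = (\<Sum>i. 1 / (1 + real i)\<^sup>2)"
  have sZ: "summable (\<lambda>i. 1 / (1 + real i)\<^sup>2)"
    using sums_summable[OF inverse_squares_sums] by (simp add: add.commute)
  define C where "C = 3 * \<sigma> ^ 4 / c\<^sup>2 * Z"
  \<comment> \<open>The three lower bounds give A + c i \<ge> c (1 + i), A \<le> A^2 and 2C/A \<le>
    \<delta> respectively.\<close>
  define A where "A = max c (max 1 (2 * C / \<delta>))"
  have A: "c \<le> A" "1 \<le> A" "2 * C / \<delta> \<le> A" by (simp_all add: A_def)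
  define b where "b i = 3 * \<sigma> ^ 4 / (A\<^sup>2 * c\<^sup>2) * (1 / (1 + real i)\<^sup>2)" for i :: nat
  have sb: "summable b"
    unfolding b_def by (intro summable_mult sZ)
  have vb: "2 * suminf b \<le> \<delta>"
  proof -
    have "suminf b = 3 * \<sigma> ^ 4 / (A\<^sup>2 * c\<^sup>2) * Z"
      unfolding b_def Z_def by (rule suminf_mult[OF sZ])
    then have "2 * suminf b = (2 * C) / (A * A)"
      by (simp add: C_def power2_eq_square)
    moreover have "2 * C \<le> \<delta> * (A * A)"
    proof -
      have "2 * C \<le> \<delta> * A"
        using A(3) \<delta> by (simp add: pos_divide_le_eq mult.commute)
      also have "\<dots> \<le> \<delta> * (A * A)"
        using A(2) \<delta> by (intro mult_left_mono) auto
      finally show ?thesis .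
    qed
    ultimately show ?thesis
      using A(2) by (simp add: pos_divide_le_eq)
  qed
  have tail: "prob {\<omega>\<in>space M. A + c * real i < \<bar>X k \<omega>\<bar>} \<le> b i" for i k
  proof -
    have "prob {\<omega>\<in>space M. A + c * real i < \<bar>X k \<omega>\<bar>} \<le> 3 * \<sigma> ^ 4 / (A + c * real i) ^ 4"
      using A pos by (intro distributed_normal_tail normal add_pos_nonneg) auto
    also have "\<dots> \<le> 3 * \<sigma> ^ 4 / (A\<^sup>2 * (c * (1 + real i))\<^sup>2)"
    proof (rule divide_left_mono)
      \<comment> \<open>Two of the four factors A + c i are bounded below by A, the other two by c
        (1 + i).\<close>
      have "A\<^sup>2 * (c * (1 + real i))\<^sup>2 \<le> (A + c * real i)\<^sup>2 * (A + c * real i)\<^sup>2"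
        using A pos by (intro mult_mono power_mono) (auto simp: algebra_simps)
      then show "A\<^sup>2 * (c * (1 + real i))\<^sup>2 \<le> (A + c * real i) ^ 4"
        by (simp add: power2_eq_square power4_eq_xxxx mult.assoc)
      have "0 < A + c * real i" using A pos by (intro add_pos_nonneg) auto
      then show "0 < (A + c * real i) ^ 4 * (A\<^sup>2 * (c * (1 + real i))\<^sup>2)"
        using A pos by (intro mult_pos_pos zero_less_power) auto
    qed simp
    also have "\<dots> = b i"
      by (simp add: b_def power_mult_distrib)
    finally show ?thesis .
  qed
  have "\<exists>B\<in>events. prob B \<le> \<eta> \<and>
    (\<forall>\<omega>\<in>space M - B. \<exists>m. (\<forall>j\<in>{m..m + int N}. S \<le> X j \<omega>) \<and>
       (\<forall>i::nat. \<bar>X (m - 1 - int i) \<omega>\<bar> \<le> A + c * real i) \<and>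
       (\<forall>i::nat. \<bar>X (m + int N + 1 + int i) \<omega>\<bar> \<le> A + c * real i))" for S :: real and N
  proof -
    define q where "q = prob {\<omega>\<in>space M. S \<le> X 0 \<omega>}"
    have q: "prob {\<omega>\<in>space M. S \<le> X j \<omega>} = q" for j
    proof -
      have vim: "{\<omega>\<in>space M. S \<le> X j \<omega>} = X j -` {S..} \<inter> space M" for j by auto
      show ?thesis
        unfolding q_def vim measure_def
        by (subst (1 2) distributed_emeasure[OF normal]) auto
    qed
    have q01: "0 < q" "q \<le> 1"
      using distributed_normal_prob_ge_pos[OF normal[of 0] pos(1), of S] by (auto simp: q_def)
    define p where "p = q ^ (N + 1)"
    have p: "0 < p" "p \<le> 1"
      using q01 by (auto simp: p_def intro!: power_le_one mult_le_one)
    \<comment> \<open>Rounding up gives K \<le> r p \<le> K + 1: the lower bound makes a run likely,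
      the upper bound controls the union over all windows.\<close>
    define r where "r = nat \<lceil>K / p\<rceil>"
    have "0 \<le> K / p" using K p by simp
    then have r: "K / p \<le> real r" "real r \<le> K / p + 1" unfolding r_def by linarith+
    have r1: "K \<le> real r * p" using r(1) p by (simp add: field_simps)
    have r2: "real r * p \<le> K + 1"
    proof -
      have "real r * p \<le> (K / p + 1) * p" using r(2) p by (intro mult_right_mono) auto
      also have "\<dots> = K + p" using p by (simp add: algebra_simps)
      finally show ?thesis using p by simp
    qed
    define m where "m i = int i * (int N + 1)" for i :: nat
    let ?J = "\<lambda>i. {m i..m i + int N}"
    have card: "card (?J i) = N + 1" for i by simp
    have disj: "disjoint_family ?J"
      unfolding disjoint_family_on_def
    proof (intro ballI impI)
      fix i i' :: nat assume "i \<noteq> i'"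
      \<comment> \<open>Windows of length N + 1 start at multiples of N + 1, so division recovers
        the window from any of its elements.\<close>
      have "x div (int N + 1) = int i" if "x \<in> ?J i" for x i
        using that by (intro int_div_pos_eq[of _ _ _ "x - m i"]) (auto simp: m_def algebra_simps)
      then show "?J i \<inter> ?J i' = {}" using \<open>i \<noteq> i'\<close> by (metis (no_types, lifting) disjoint_iff of_nat_eq_iff)
    qed
    let ?L = "\<lambda>i \<omega>. \<forall>j\<in>?J i. S \<le> X j \<omega>"
    \<comment> \<open>Either none of the r windows carries a run (\<open>B0\<close>), or some run
      has a bad innovation before it (\<open>B1\<close>) or after it (\<open>B2\<close>). The latter
      events include the run, and so carry the factor p.\<close>
    define B0 where "B0 = {\<omega>\<in>space M. \<forall>i<r. \<not> ?L i \<omega>}"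
    define B1 where "B1 i = {\<omega>\<in>space M. ?L i \<omega> \<and> (\<exists>k::nat. A + c * real k < \<bar>X (m i - 1 - int k) \<omega>\<bar>)}" for i
    define B2 where "B2 i = {\<omega>\<in>space M. ?L i \<omega> \<and> (\<exists>k::nat. A + c * real k < \<bar>X (m i + int N + 1 + int k) \<omega>\<bar>)}" for i
    have prL: "prob {\<omega>\<in>space M. ?L i \<omega>} = p" for i
      using indep_vars_block(1)[OF X _ _ q, of "?J i" "m i - 1"]
      by (simp add: p_def nat_add_distrib)
    have B0: "B0 \<in> events" "prob B0 \<le> \<eta> / 2"
    proof -
      have "space M - {\<omega>\<in>space M. ?L i \<omega>} \<in> events" for i
        by (intro sets.compl_sets indep_vars_block_events[OF X]) simp
      moreover have "space M - {\<omega>\<in>space M. ?L i \<omega>} = {\<omega>\<in>space M. \<not> ?L i \<omega>}" for i by auto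
      ultimately have "{\<omega>\<in>space M. \<forall>i\<in>{..<r}. \<not> ?L i \<omega>} \<in> events"
        by (intro sets.sets_Collect_finite_All) auto
      then show "B0 \<in> events" by (simp only: B0_def lessThan_iff Ball_def)
      have "prob B0 \<le> (1 - p) ^ r"
        unfolding B0_def by (rule indep_vars_no_block[OF X _ disj prL]) simp
      \<comment> \<open>Uses 1 - p \<le> e^(-p).\<close>
      also have "\<dots> \<le> exp (- p) ^ r"
        using p exp_ge_add_one_self[of "- p"] by (intro power_mono) auto
      also have "\<dots> = exp (- (real r * p))"
        by (simp add: exp_of_nat_mult[symmetric])
      also have "\<dots> \<le> exp (- K)" using r1 by simp
      finally show "prob B0 \<le> \<eta> / 2" using K by simp
    qed
    have B1: "B1 i \<in> events" "prob (B1 i) \<le> p * suminf b" for i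
      using indep_vars_block_tail[OF X _ _ q tail sb, of "?J i" "\<lambda>k. m i - 1 - int k"]
      by (simp_all add: B1_def p_def nat_add_distrib)
    have B2: "B2 i \<in> events" "prob (B2 i) \<le> p * suminf b" for i
      using indep_vars_block_tail[OF X _ _ q tail sb, of "?J i" "\<lambda>k. m i + int N + 1 + int k"]
      by (simp_all add: B2_def p_def nat_add_distrib)
    have B12: "prob (\<Union>i<r. B1 i \<union> B2 i) \<le> \<eta> / 2"
    proof -
      have "prob (\<Union>i<r. B1 i \<union> B2 i) \<le> (\<Sum>i<r. prob (B1 i \<union> B2 i))"
        using B1 B2 by (intro finite_measure_subadditive_finite) auto
      also have "\<dots> \<le> (\<Sum>i<r. p * \<delta>)"
      proof (rule sum_mono)
        fix i
        have "prob (B1 i \<union> B2 i) \<le> p * suminf b + p * suminf b"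
          using measure_Un_le[OF B1(1)[of i] B2(1)[of i]] B1(2)[of i] B2(2)[of i] by simp
        also have "\<dots> = p * (2 * suminf b)" by simp
        also have "\<dots> \<le> p * \<delta>" using p vb by (intro mult_left_mono) auto
        finally show "prob (B1 i \<union> B2 i) \<le> p * \<delta>" .
      qed
      also have "\<dots> = (real r * p) * \<delta>" by simp
      \<comment> \<open>Here \<delta> was fixed as \<eta>/2 divided by K + 1, before p and r were
        known.\<close>
      also have "\<dots> \<le> (K + 1) * \<delta>" using r2 \<delta> by (intro mult_right_mono) auto
      also have "\<dots> = \<eta> / 2"
        using K nonzero_mult_div_cancel_left[of "K + 1" "\<eta> / 2"]
        by (simp only: \<delta>_def times_divide_eq_right)
      finally show ?thesis .
    qed
    let ?B = "B0 \<union> (\<Union>i<r. B1 i \<union> B2 i)"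
    have un: "(\<Union>i<r. B1 i \<union> B2 i) \<in> events"
      using B1(1) B2(1) by (intro sets.finite_UN sets.Un) auto
    then have "?B \<in> events" using B0(1) by (intro sets.Un)
    moreover have "prob ?B \<le> \<eta>"
      using measure_Un_le[OF B0(1) un] B0(2) B12 by simp
    moreover have "\<exists>m. (\<forall>j\<in>{m..m + int N}. S \<le> X j \<omega>) \<and>
       (\<forall>i::nat. \<bar>X (m - 1 - int i) \<omega>\<bar> \<le> A + c * real i) \<and>
       (\<forall>i::nat. \<bar>X (m + int N + 1 + int i) \<omega>\<bar> \<le> A + c * real i)" if "\<omega> \<in> space M - ?B" for \<omega>
    proof -
      have \<omega>: "\<omega> \<in> space M" "\<omega> \<notin> B0" "\<And>i. i < r \<Longrightarrow> \<omega> \<notin> B1 i \<and> \<omega> \<notin> B2 i"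
        using that by auto
      then obtain i where i: "i < r" "?L i \<omega>" unfolding B0_def by blast
      have "\<bar>X (m i - 1 - int k) \<omega>\<bar> \<le> A + c * real k" for k
        using \<omega>(3)[OF i(1)] i(2) \<omega>(1) by (force simp: B1_def not_less)
      moreover have "\<bar>X (m i + int N + 1 + int k) \<omega>\<bar> \<le> A + c * real k" for k
        using \<omega>(3)[OF i(1)] i(2) \<omega>(1) by (force simp: B2_def not_less)
      ultimately show ?thesis using i(2) by blast
    qed
    ultimately show ?thesis by (intro bexI[of _ ?B] conjI ballI)
  qed
  then show ?thesis
    using A(2) by (intro exI[of _ A]) auto
qed

lemma AE_AR1_gap:
  fixes X \<theta> :: "int \<Rightarrow> 'a \<Rightarrow> real"
  assumes X: "indep_vars (\<lambda>_. borel) X UNIV"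
    and normal: "\<And>n. distributed M lborel (X n) (normal_density 0 \<sigma>)"
    and \<sigma>: "0 < \<sigma>" and \<phi>: "0 < \<phi>" "\<phi> < 1"
    and \<theta>: "\<And>n \<omega>. \<theta> n \<omega> = of_int n + (\<Sum>k. \<phi> ^ k * X (n - int k) \<omega>)"
  shows "AE \<omega> in M. \<exists>m x R. R0 \<le> R \<and> (\<forall>n. (\<bar>of_int (n - m)\<bar> + R) / 4 \<le> \<bar>\<theta> n \<omega> - x\<bar>)"
proof (rule AE_I_small_exceptions)
  fix \<eta> :: real assume \<eta>: "0 < \<eta>"
  define c where "c = (1 - \<phi>) / 4"
  have "0 < c" using \<phi> by (simp add: c_def)
  from normal_block_with_small_surroundings[OF X normal \<sigma> this \<eta>]
  obtain A where A: "0 < A" and ex: "\<And>S N. \<exists>B\<in>events. prob B \<le> \<eta> \<and>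
    (\<forall>\<omega>\<in>space M - B. \<exists>m. (\<forall>j\<in>{m..m + int N}. S \<le> X j \<omega>) \<and>
       (\<forall>i::nat. \<bar>X (m - 1 - int i) \<omega>\<bar> \<le> A + c * real i) \<and>
       (\<forall>i::nat. \<bar>X (m + int N + 1 + int i) \<omega>\<bar> \<le> A + c * real i))"
    by blast
  \<comment> \<open>D depends only on A, c and \<phi>, so R and then the run length N can be chosen
    from it without altering A.\<close>
  define D where "D = (\<Sum>k. \<phi> ^ k * (A + c * real k))"
  define R where "R = max R0 (4 * D)"
  obtain N where N: "2 * R \<le> real N" using real_arch_simple by blast
  have R: "R0 \<le> R" "4 * D \<le> R" by (simp_all add: R_def)
  obtain B where B: "B \<in> events" "prob B \<le> \<eta>" and good:
    "\<And>\<omega>. \<omega> \<in> space M - B \<Longrightarrow> \<exists>m. (\<forall>j\<in>{m..m + int N}. R + D \<le> X j \<omega>) \<and>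
       (\<forall>i::nat. \<bar>X (m - 1 - int i) \<omega>\<bar> \<le> A + c * real i) \<and>
       (\<forall>i::nat. \<bar>X (m + int N + 1 + int i) \<omega>\<bar> \<le> A + c * real i)"
    using ex[of N "R + D"] by blast
  show "\<exists>B\<in>events. prob B \<le> \<eta> \<and> (\<forall>\<omega>\<in>space M - B.
      \<exists>m x R. R0 \<le> R \<and> (\<forall>n. (\<bar>of_int (n - m)\<bar> + R) / 4 \<le> \<bar>\<theta> n \<omega> - x\<bar>))"
  proof (intro bexI[of _ B] conjI ballI B)
    fix \<omega> assume "\<omega> \<in> space M - B"
    then obtain m where m: "\<And>j. j \<in> {m..m + int N} \<Longrightarrow> R + D \<le> X j \<omega>"
       "\<And>i::nat. \<bar>X (m - 1 - int i) \<omega>\<bar> \<le> A + c * real i"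
       "\<And>i::nat. \<bar>X (m + int N + 1 + int i) \<omega>\<bar> \<le> A + c * real i"
      using good by blast
    \<comment> \<open>The deterministic gap has its run at 0; shifting indices by m moves its centre
      to m + R/2.\<close>
    have "(\<bar>of_int (n - m)\<bar> + R) / 4 \<le> \<bar>\<theta> n \<omega> - (of_int m + R / 2)\<bar>" for n
    proof -
      have "(\<bar>of_int (n - m)\<bar> + R) / 4 \<le>
          \<bar>of_int (n - m) + (\<Sum>k. \<phi> ^ k * X (m + (n - m - int k)) \<omega>) - R / 2\<bar>"
      proof (rule AR1_gap[OF \<phi> c_def _ D_def R(2) N, where e = "\<lambda>j. X (m + j) \<omega>"])
        show "R + D \<le> X (m + j) \<omega>" if "j \<in> {0..int N}" for j
          using that by (intro m(1)) auto
        show "\<bar>X (m + (- 1 - int i)) \<omega>\<bar> \<le> A + c * real i" for i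
          using m(2)[of i] by (simp add: algebra_simps)
        show "\<bar>X (m + (int N + 1 + int i)) \<omega>\<bar> \<le> A + c * real i" for i
          using m(3)[of i] by (simp add: algebra_simps)
      qed (use A in simp)
      also have "of_int (n - m) + (\<Sum>k. \<phi> ^ k * X (m + (n - m - int k)) \<omega>) - R / 2 =
          \<theta> n \<omega> - (of_int m + R / 2)"
        by (simp add: \<theta> algebra_simps)
      finally show ?thesis .
    qed
    then show "\<exists>m x R. R0 \<le> R \<and> (\<forall>n. (\<bar>of_int (n - m)\<bar> + R) / 4 \<le> \<bar>\<theta> n \<omega> - x\<bar>)"
      using R(1) by blast
  qed
qed

end

subsection \<open>Failure of stable sampling\<close>

text \<open>A sampling constant K would give |s|^2 \<le> K^2 |s|^2 / k in the L2 norm, which is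
  impossible for k > K^2 since the norm is positive. Summability is required because
  \<open>stable_sampling\<close> constrains only square-summable samples.\<close>

lemma not_stable_sampling_of_small_samples:
  assumes V: "V \<subseteq> paley_wiener A"
    and s: "\<And>k::nat. 1 \<le> k \<Longrightarrow> s k \<in> V \<and> s k \<noteq> (\<lambda>_. 0) \<and>
      (\<lambda>n. (norm (s k (t n)))\<^sup>2) summable_on UNIV \<and>
      (\<Sum>\<^sub>\<infinity>n. (norm (s k (t n)))\<^sup>2) \<le> (L2_fun_norm (s k))\<^sup>2 / real k"
  shows "\<not> stable_sampling t V"
proof
  assume "stable_sampling t V"
  then obtain K where K: "\<And>f. f \<in> V \<Longrightarrow> (\<lambda>n. (norm (f (t n)))\<^sup>2) summable_on UNIV \<Longrightarrow>
      L2_fun_norm f \<le> K * sqrt (\<Sum>\<^sub>\<infinity>n. (norm (f (t n)))\<^sup>2)"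
    unfolding stable_sampling_def by blast
  obtain k :: nat where k: "max 1 (K\<^sup>2) < real k"
    using reals_Archimedean2 by blast
  define Q where "Q = (\<Sum>\<^sub>\<infinity>n. (norm (s k (t n)))\<^sup>2)"
  have k1: "1 \<le> k" using k by simp
  note sk = s[OF k1, folded Q_def]
  have Q0: "0 \<le> Q" unfolding Q_def by (rule infsum_nonneg) simp
  have "s k \<in> paley_wiener A" using sk V by auto
  then have pos: "0 < L2_fun_norm (s k)"
    using sk by (intro L2_fun_norm_pos) (auto simp: paley_wiener_def)
  have "L2_fun_norm (s k) \<le> K * sqrt Q"
    using K[of "s k"] sk unfolding Q_def by blast
  \<comment> \<open>Squaring is monotone here because the smaller side is positive; the sign of K is
    unknown.\<close>
  then have "(L2_fun_norm (s k))\<^sup>2 \<le> (K * sqrt Q)\<^sup>2"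
    using pos by (intro power_mono) auto
  also have "\<dots> = K\<^sup>2 * Q"
    using Q0 by (simp add: power_mult_distrib)
  also have "\<dots> \<le> K\<^sup>2 * ((L2_fun_norm (s k))\<^sup>2 / real k)"
    using sk by (intro mult_left_mono) auto
  finally have "(L2_fun_norm (s k))\<^sup>2 * real k \<le> (L2_fun_norm (s k))\<^sup>2 * K\<^sup>2"
    using k by (simp add: field_simps)
  then show False
    using pos k by (simp add: mult_le_cancel_left)
qed

theorem theorem2:
  fixes M :: "'a measure" and \<epsilon> \<xi> \<theta> :: "int \<Rightarrow> 'a \<Rightarrow> real" and \<phi> \<sigma> :: real
  assumes "prob_space M"
    and "0 < \<phi>" and "\<phi> < 1" and "0 < \<sigma>"
    and "prob_space.indep_vars M (\<lambda>_. borel) \<epsilon> UNIV"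
    and "\<And>n. distributed M lborel (\<epsilon> n) (normal_density 0 \<sigma>)"
    and "\<And>n \<omega>. \<xi> n \<omega> = (\<Sum>k. \<phi> ^ k * \<epsilon> (n - int k) \<omega>)"
    and "\<And>n \<omega>. \<theta> n \<omega> = of_int n + \<xi> n \<omega>"
  shows "(AE \<omega> in M. \<exists>s :: nat \<Rightarrow> real \<Rightarrow> complex. \<forall>k\<ge>1.
            s k \<in> paley_wiener {-1/2..1/2} \<and> s k \<noteq> (\<lambda>_. 0) \<and>
            (\<lambda>n::int. (norm (s k (\<theta> n \<omega>)))\<^sup>2) summable_on UNIV \<and>
            (\<Sum>\<^sub>\<infinity>n::int. (norm (s k (\<theta> n \<omega>)))\<^sup>2) \<le> (L2_fun_norm (s k))\<^sup>2 / real k) \<and>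
         (AE \<omega> in M. \<not> stable_sampling (\<lambda>n. \<theta> n \<omega>) (paley_wiener {-1/2..1/2}))"
proof -
  interpret prob_space M by fact
  let ?P = "\<lambda>\<omega> k s. s \<in> paley_wiener {-1/2..1/2} \<and> s \<noteq> (\<lambda>_. 0) \<and>
      (\<lambda>n::int. (norm (s (\<theta> n \<omega>)))\<^sup>2) summable_on UNIV \<and>
      (\<Sum>\<^sub>\<infinity>n::int. (norm (s (\<theta> n \<omega>)))\<^sup>2) \<le> (L2_fun_norm s)\<^sup>2 / real k"
  define Z :: real where "Z = (\<Sum>\<^sub>\<infinity>n::int. 1 / (1 + \<bar>of_int n\<bar>)\<^sup>2)"
  define E where "E = (L2_fun_norm (bump 0))\<^sup>2"
  have Z0: "0 \<le> Z" unfolding Z_def by (rule infsum_nonneg) simp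
  have E0: "0 < E"
    unfolding E_def
    by (intro zero_less_power L2_fun_norm_pos continuous_on_bump square_integrable_bump bump_neq_0)
  have bound: "AE \<omega> in M. 1 \<le> k \<longrightarrow> (\<exists>s. ?P \<omega> k s)" for k :: nat
  proof (cases "1 \<le> k")
    case True
    \<comment> \<open>Chosen so that 256 Z / R^2 \<le> E / k for every R \<ge> \<open>R0\<close>,
      using R \<le> R^2.\<close>
    define R0 where "R0 = max 1 (256 * Z * real k / E)"
    have "AE \<omega> in M. \<exists>m x R. R0 \<le> R \<and> (\<forall>n. (\<bar>of_int (n - m)\<bar> + R) / 4 \<le> \<bar>\<theta> n \<omega> - x\<bar>)"
      using assms by (intro AE_AR1_gap[where X = \<epsilon> and \<sigma> = \<sigma> and \<phi> = \<phi>]) auto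
    then show ?thesis
    proof eventually_elim
      case (elim \<omega>)
      then obtain m x R where R: "R0 \<le> R"
        and gap: "\<And>n. (\<bar>of_int (n - m)\<bar> + R) / 4 \<le> \<bar>\<theta> n \<omega> - x\<bar>" by blast
      have R1: "1 \<le> R" "256 * Z * real k / E \<le> R" using R by (simp_all add: R0_def)
      note samples = bump_samples[OF R1(1) gap, folded Z_def]
      have "256 * Z * real k / E \<le> R\<^sup>2"
        using R1 self_le_power[of R 2] by linarith
      then have "256 / R\<^sup>2 * Z \<le> E / real k"
        using R1 True E0 by (simp add: field_simps)
      then have "?P \<omega> k (bump x)"
        using samples bump_in_paley_wiener bump_neq_0 L2_fun_norm_bump[of x]
        by (auto simp: E_def)
      then show ?case by blast
    qed
  qed simp
  \<comment> \<open>Countably many k share one null set; the functions are then chosen separately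
    for each outcome.\<close>
  have "AE \<omega> in M. \<forall>k::nat. 1 \<le> k \<longrightarrow> (\<exists>s. ?P \<omega> k s)"
    unfolding AE_all_countable using bound by blast
  then have ex: "AE \<omega> in M. \<exists>s :: nat \<Rightarrow> real \<Rightarrow> complex. \<forall>k\<ge>1. ?P \<omega> k (s k)"
    by eventually_elim metis
  then have "AE \<omega> in M. \<not> stable_sampling (\<lambda>n. \<theta> n \<omega>) (paley_wiener {-1/2..1/2})"
  proof eventually_elim
    case (elim \<omega>)
    then obtain s :: "nat \<Rightarrow> real \<Rightarrow> complex" where "\<forall>k\<ge>1. ?P \<omega> k (s k)" by blast
    then show ?case
      by (intro not_stable_sampling_of_small_samples[OF order_refl, where s = s]) blast
  qed
  with ex show ?thesis by blast
qed

end
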